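(* Let $G$ be an alternating labeled graph without isolated vertices. Then $G$ is minimal, that is, there is no labeled graph $G'$ with strictly smaller number of vertices representing the same graph-link as $G$.
   Context: A labeled graph is a finite simple graph $G$ (no loops, no multiple edges) in which every vertex carries a label '$+$' or '$-$' (identified with $+1,-1$). $N(v)$ is the set of vertices adjacent to $v$. $A(G)$ is the adjacency matrix over $\mathbb{Z}_2$ (zero diagonal). For an $m\times m$ matrix $M$ over $\mathbb{Z}_2$, $\operatorname{corank}M=m-\operatorname{rank}M$ (the corank of the empty matrix is $0$). A state is a subset $s\subseteq V(G)$; $G(s)$ is the induced subgraph on $s$; the number of circles in $s$ is $\operatorname{corank}A(G(s))+1$. The $A$-state is the set of all vertices labeled '$-$'; the $B$-state is the set of all vertices labeled '$+$'. A labeled graph $G$ on $n$ vertices is alternating if $k+l=n+2$, where $k$ and $l$ are the numbers of circles in the $A$-state and the $B$-state respectively. Graph-moves. $\Omega_g1$: addition/removal of an isolated vertex labeled '$+$' or '$-$'. $\Omega_g2$: addition/removal of two non-adjacent vertices having different labels and the same adjacencies with all other vertices. $\Omega_g3$: let $u,v,w$ be three distinct vertices all labeled '$-$', with $v,w$ not adjacent to each other and $u$ adjacent exactly to $v$ and $w$; change (toggle) the adjacency of $u$ with $v$, with $w$, and with every $t\in (N(v)\setminus N(w))\cup(N(w)\setminus N(v))$, and change the labels of $v$ and $w$ to '$+$', leaving everything else unchanged; the inverse operation is also called $\Omega_g3$. $\Omega_g4$: let $u$ labeled $\epsilon$ and $v$ labeled $\delta$ be adjacent vertices ($\epsilon,\delta\in\{\pm1\}$);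 the new label of $u$ is $-\delta$ and the new label of $v$ is $-\epsilon$; moreover, the adjacency is toggled for each unordered pair $\{t,w\}$ of vertices different from $u,v$ such that $t\in N(u)$, $w\in N(v)\setminus N(u)$, or $t\in N(v)$, $w\in N(u)\setminus N(v)$ (each such unordered pair being toggled once); everything else is unchanged. A graph-link is an equivalence class of labeled graphs modulo $\Omega_g1$–$\Omega_g4$. *)

theory Defs
  imports
    Complex_Main
    "HOL-Library.Z2"
    "HOL-Library.Function_Algebras"
    "HOL-Library.Infinite_Typeclass"
begin

section \<open>Corank of a matrix over the two-element field\<close>

text \<open>
  A square matrix whose rows and columns are indexed by a finite set \<open>S\<close> is a function
  \<open>M :: 'a \<Rightarrow> 'a \<Rightarrow> bit\<close>, of which only the entries \<open>M i j\<close> with \<open>i, j \<in> S\<close> are used. Its columns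
  are vectors in \<open>'a \<Rightarrow> bit\<close>, extended by \<open>0\<close> outside \<open>S\<close>.
\<close>

global_interpretation Z2_fun: vector_space "\<lambda>(c::bit) (f::'a \<Rightarrow> bit) i. c * f i"
  by unfold_locales (auto simp: fun_eq_iff algebra_simps)

definition matrix_column :: "'a set \<Rightarrow> ('a \<Rightarrow> 'a \<Rightarrow> bit) \<Rightarrow> 'a \<Rightarrow> 'a \<Rightarrow> bit" where
  "matrix_column S M j = (\<lambda>i. if i \<in> S then M i j else 0)"

definition matrix_rank :: "'a set \<Rightarrow> ('a \<Rightarrow> 'a \<Rightarrow> bit) \<Rightarrow> nat" where
  "matrix_rank S M = Z2_fun.dim (matrix_column S M ` S)"

definition corank :: "'a set \<Rightarrow> ('a \<Rightarrow> 'a \<Rightarrow> bit) \<Rightarrow> nat" where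
  "corank S M = card S - matrix_rank S M"


section \<open>Labeled graphs, states and circles\<close>

datatype sign = Plus | Minus

fun opposite :: "sign \<Rightarrow> sign" where
  "opposite Plus = Minus"
| "opposite Minus = Plus"

text \<open>The values of \<open>lab\<close> outside the vertex set are irrelevant.\<close>

record 'a lgraph =
  verts :: "'a set"
  adj :: "'a \<Rightarrow> 'a \<Rightarrow> bool"
  lab :: "'a \<Rightarrow> sign"

definition labeled_graph :: "'a lgraph \<Rightarrow> bool" where
  "labeled_graph G \<longleftrightarrow>
     finite (verts G) \<and>
     (\<forall>u v. adj G u v \<longrightarrow> u \<in> verts G \<and> v \<in> verts G) \<and>
     (\<forall>u v. adj G u v \<longrightarrow> adj G v u) \<and>
     (\<forall>v. \<not> adj G v v)"

definition nbhd :: "'a lgraph \<Rightarrow> 'a \<Rightarrow> 'a set" where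
  "nbhd G v = {u \<in> verts G. adj G v u}"

definition isolated :: "'a lgraph \<Rightarrow> 'a \<Rightarrow> bool" where
  "isolated G v \<longleftrightarrow> v \<in> verts G \<and> nbhd G v = {}"

definition induced :: "'a lgraph \<Rightarrow> 'a set \<Rightarrow> 'a lgraph" where
  "induced G s = G\<lparr>verts := s, adj := (\<lambda>u v. u \<in> s \<and> v \<in> s \<and> adj G u v)\<rparr>"

definition adj_matrix :: "'a lgraph \<Rightarrow> 'a \<Rightarrow> 'a \<Rightarrow> bit" where
  "adj_matrix G u v = (if adj G u v then 1 else 0)"

definition circles :: "'a lgraph \<Rightarrow> 'a set \<Rightarrow> nat" where
  "circles G s = corank s (adj_matrix (induced G s)) + 1"

definition A_state :: "'a lgraph \<Rightarrow> 'a set" where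
  "A_state G = {v \<in> verts G. lab G v = Minus}"

definition B_state :: "'a lgraph \<Rightarrow> 'a set" where
  "B_state G = {v \<in> verts G. lab G v = Plus}"

definition alternating :: "'a lgraph \<Rightarrow> bool" where
  "alternating G \<longleftrightarrow> circles G (A_state G) + circles G (B_state G) = card (verts G) + 2"


section \<open>Graph-moves and graph-links\<close>

definition isomorphic :: "'a lgraph \<Rightarrow> 'a lgraph \<Rightarrow> bool" where
  "isomorphic G H \<longleftrightarrow>
     (\<exists>f. bij_betw f (verts G) (verts H) \<and>
          (\<forall>u\<in>verts G. \<forall>v\<in>verts G. adj H (f u) (f v) \<longleftrightarrow> adj G u v) \<and>
          (\<forall>v\<in>verts G. lab H (f v) = lab G v))"

text \<open>Toggle the adjacency of every unordered pair belonging to \<open>T\<close>.\<close>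

definition toggle :: "'a set set \<Rightarrow> 'a lgraph \<Rightarrow> 'a lgraph" where
  "toggle T G = G\<lparr>adj := (\<lambda>x y. if {x, y} \<in> T then \<not> adj G x y else adj G x y)\<rparr>"

definition relabel :: "('a \<Rightarrow> sign) \<Rightarrow> 'a lgraph \<Rightarrow> 'a lgraph" where
  "relabel l G = G\<lparr>lab := l\<rparr>"

definition omega3_pairs :: "'a lgraph \<Rightarrow> 'a \<Rightarrow> 'a \<Rightarrow> 'a \<Rightarrow> 'a set set" where
  "omega3_pairs G u v w =
     {{u, v}, {u, w}} \<union>
     {{u, t} | t. t \<in> (nbhd G v - nbhd G w) \<union> (nbhd G w - nbhd G v)}"

definition omega4_pairs :: "'a lgraph \<Rightarrow> 'a \<Rightarrow> 'a \<Rightarrow> 'a set set" where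
  "omega4_pairs G u v =
     {{t, w} | t w. t \<notin> {u, v} \<and> w \<notin> {u, v} \<and>
        (t \<in> nbhd G u \<and> w \<in> nbhd G v - nbhd G u \<or>
         t \<in> nbhd G v \<and> w \<in> nbhd G u - nbhd G v)}"

text \<open>
  One direction of each move; the inverses enter through the equivalence closure below. The moves
  \<open>omega1\<close> and \<open>omega2\<close> are given as removals, so that additions are their inverses. Graphs are
  considered up to isomorphism, hence \<open>iso\<close>, which also makes the labels outside the vertex set
  immaterial.
\<close>

inductive graph_move :: "'a lgraph \<Rightarrow> 'a lgraph \<Rightarrow> bool" where
  iso: "graph_move G H"
    if "labeled_graph G" "labeled_graph H" "isomorphic G H"
| omega1: "graph_move G (induced G (verts G - {v}))"
    if "labeled_graph G" "isolated G v"
| omega2: "graph_move G (induced G (verts G - {u, v}))"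
    if "labeled_graph G" "u \<in> verts G" "v \<in> verts G" "u \<noteq> v" "\<not> adj G u v" "lab G u \<noteq> lab G v"
      "\<forall>t \<in> verts G - {u, v}. adj G u t \<longleftrightarrow> adj G v t"
| omega3: "graph_move G
      (relabel ((lab G)(v := Plus, w := Plus)) (toggle (omega3_pairs G u v w) G))"
    if "labeled_graph G" "u \<in> verts G" "v \<in> verts G" "w \<in> verts G" "u \<noteq> v" "u \<noteq> w" "v \<noteq> w"
      "lab G u = Minus" "lab G v = Minus" "lab G w = Minus"
      "\<not> adj G v w" "nbhd G u = {v, w}"
| omega4: "graph_move G
      (relabel ((lab G)(u := opposite (lab G v), v := opposite (lab G u)))
        (toggle (omega4_pairs G u v) G))"
    if "labeled_graph G" "u \<in> verts G" "v \<in> verts G" "adj G u v"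

text \<open>
  The vertices come from an infinite type, so that fresh vertices for the additions are always
  available and every finite labeled graph occurs up to isomorphism.
\<close>

definition graph_link :: "'a::infinite lgraph \<Rightarrow> 'a lgraph set" where
  "graph_link G = {H. labeled_graph H \<and> equivclp graph_move G H}"

definition minimal :: "'a::infinite lgraph \<Rightarrow> bool" where
  "minimal G \<longleftrightarrow>
     \<not> (\<exists>G'. labeled_graph G' \<and> card (verts G') < card (verts G) \<and> graph_link G' = graph_link G)"


section \<open>Moves preserve labeled graphs\<close>

lemma labeled_graph_induced:
  "labeled_graph G \<Longrightarrow> s \<subseteq> verts G \<Longrightarrow> labeled_graph (induced G s)"
  by (auto simp: labeled_graph_def induced_def intro: finite_subset)

lemma labeled_graph_toggle:
  assumes "labeled_graph G"
    and "\<And>x y. {x, y} \<in> T \<Longrightarrow> x \<in> verts G \<and> y \<in> verts G \<and> x \<noteq> y"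
  shows "labeled_graph (relabel l (toggle T G))"
proof -
  have "{x, x} \<notin> T" for x using assms(2)[of x x] by blast
  moreover have "{x, y} \<in> T \<longleftrightarrow> {y, x} \<in> T" for x y by (simp only: insert_commute)
  ultimately show ?thesis
    using assms unfolding labeled_graph_def toggle_def relabel_def
    by (simp del: insert_absorb2 split: if_splits) meson
qed

lemma graph_move_labeled_graph:
  assumes "graph_move G H"
  shows "labeled_graph G" and "labeled_graph H"
proof -
  show "labeled_graph G" using assms by cases
  show "labeled_graph H" using assms
  proof cases
    case (omega1 v)
    then show ?thesis by (auto intro: labeled_graph_induced)
  next
    case (omega2 u v)
    then show ?thesis by (auto intro: labeled_graph_induced)
  next
    case (omega3 u v w)
    have sub: "nbhd G z \<subseteq> verts G" for z by (auto simp: nbhd_def)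
    have "v \<in> nbhd G u" "w \<in> nbhd G u" by (simp_all add: \<open>nbhd G u = {v, w}\<close>)
    then have N: "u \<in> nbhd G v" "u \<in> nbhd G w"
      using \<open>labeled_graph G\<close> \<open>u \<in> verts G\<close> by (simp_all add: nbhd_def labeled_graph_def)
    have V: "x \<in> verts G \<and> y \<in> verts G \<and> x \<noteq> y"
      if xy: "{x, y} \<in> omega3_pairs G u v w" for x y
    proof -
      consider "{x, y} = {u, v}" | "{x, y} = {u, w}"
        | t where "{x, y} = {u, t}" "t \<in> nbhd G v - nbhd G w \<or> t \<in> nbhd G w - nbhd G v"
        using xy unfolding omega3_pairs_def by blast
      then obtain t where t: "{x, y} = {u, t}" "t \<in> verts G" "u \<noteq> t"
      proof cases
        case 1
        show ?thesis by (rule that[OF 1]) fact+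
      next
        case 2
        show ?thesis by (rule that[OF 2]) fact+
      next
        case (3 t)
        then have "t \<in> verts G" "u \<noteq> t" using sub N by blast+
        then show ?thesis by (rule that[OF 3(1)])
      qed
      from t(1) have "x = u \<and> y = t \<or> x = t \<and> y = u" by (simp add: doubleton_eq_iff)
      with t(2,3) \<open>u \<in> verts G\<close> show ?thesis by metis
    qed
    show ?thesis unfolding omega3(1) by (rule labeled_graph_toggle[OF omega3(2) V])
  next
    case (omega4 u v)
    have V: "x \<in> verts G \<and> y \<in> verts G \<and> x \<noteq> y" if "{x, y} \<in> omega4_pairs G u v" for x y
    proof -
      from that obtain t w where tw: "{x, y} = {t, w}"
        and "t \<in> nbhd G u \<and> w \<in> nbhd G v - nbhd G u \<or> t \<in> nbhd G v \<and> w \<in> nbhd G u - nbhd G v"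
        unfolding omega4_pairs_def by blast
      then have "t \<in> verts G" "w \<in> verts G" "t \<noteq> w" by (auto simp: nbhd_def)
      moreover from tw have "x = t \<and> y = w \<or> x = w \<and> y = t" by (simp add: doubleton_eq_iff)
      ultimately show ?thesis by metis
    qed
    show ?thesis unfolding omega4(1) by (rule labeled_graph_toggle[OF omega4(2) V])
  qed
qed

lemma graph_link_eq_iff:
  assumes "labeled_graph G" and "labeled_graph H"
  shows "graph_link G = graph_link H \<longleftrightarrow> equivclp graph_move G H"
proof
  assume "graph_link G = graph_link H"
  moreover have "H \<in> graph_link H" using assms by (simp add: graph_link_def)
  ultimately have "H \<in> graph_link G" by simp
  then show "equivclp graph_move G H" by (simp add: graph_link_def)
next
  assume "equivclp graph_move G H"
  then have "equivclp graph_move G K \<longleftrightarrow> equivclp graph_move H K" for K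
    using equivclp_trans[of graph_move G H K] equivclp_trans[of graph_move H G K]
      equivclp_sym[of graph_move G H] by metis
  then show "graph_link G = graph_link H" by (simp add: graph_link_def)
qed

end

theory Submission
  imports Defs
begin

text \<open>
  The Kauffman bracket, the sum over all states of \<open>a^(\<alpha> - \<beta>) (-a^2 - a^(-2))^corank\<close>, is invariant
  under the moves up to powers of \<open>-(a^3)\<close>, so the product \<open>Q a\<close> of its values at \<open>a\<close> and \<open>1/a\<close> is
  an invariant of the graph-link. A state \<open>s\<close> has corank at most \<open>card s\<close>, hence
  \<open>Q a = O(a^(4 n))\<close> for a graph on \<open>n\<close> vertices. A graph is alternating iff no edge joins two
  vertices with the same label; if moreover no vertex is isolated, then the bound on the exponent
  is attained by the \<open>A\<close>-state alone, and at the other end by the \<open>B\<close>-state alone, so the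
  coefficient of \<open>a^(4 n)\<close> is \<open>1\<close> or \<open>-1\<close>. An equivalent graph on fewer vertices is therefore
  impossible.
\<close>

text \<open>Keeps sums and products over \<open>bit\<close> in ring form, where
  \<open>algebra_simps\<close> and the lemmas on finite sums apply, instead of turning them into
  bitwise operations.\<close>

declare add_bit_eq_xor [simp del] mult_bit_eq_and [simp del] minus_bit_def [simp del]

lemma bit_add_self [simp]: "a + a = 0" for a :: bit
  by (cases a) simp_all

lemma bit_add_self_left [simp]: "a + (a + b) = b" for a b :: bit
  by (simp flip: add.assoc)

section \<open>Coranks over the two-element field\<close>

text \<open>Vectors vanish outside \<open>S\<close>, so each vector on \<open>S\<close> has exactly
  one representative and kernels can be counted. Coranks are compared below by bijections between
  kernels.\<close>

definition kernel :: "'a set \<Rightarrow> ('a \<Rightarrow> 'a \<Rightarrow> bit) \<Rightarrow> ('a \<Rightarrow> bit) set" where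
  "kernel S M = {x. (\<forall>i. i \<notin> S \<longrightarrow> x i = 0) \<and> (\<forall>i\<in>S. (\<Sum>j\<in>S. M i j * x j) = 0)}"

section \<open>Cardinalities of spans and kernels\<close>

lemma card_Z2_span_independent:
  fixes B :: "('a \<Rightarrow> bit) set"
  assumes "finite B" "Z2_fun.independent B"
  shows "finite (Z2_fun.span B) \<and> card (Z2_fun.span B) = 2 ^ card B"
  using assms
proof (induction B rule: finite_induct)
  case empty
  then show ?case by simp
next
  case (insert b B)
  then have ind: "Z2_fun.independent B" and b: "b \<notin> Z2_fun.span B"
    by (auto simp: Z2_fun.independent_insert)
  \<comment> \<open>The only scalars are 0 and 1, so the existential in \<open>span_insert\<close>
    leaves the old span and its coset by \<open>b\<close>. The two are disjoint, which doubles the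
    size.\<close>
  have two: "P 0 \<or> P 1 \<longleftrightarrow> (\<exists>k::bit. P k)" for P by (metis bit.exhaust)
  have "Z2_fun.span (insert b B) = Z2_fun.span B \<union> (\<lambda>x. x + b) ` Z2_fun.span B"
    (is "_ = ?U \<union> ?f ` ?U")
  proof -
    have "x \<in> Z2_fun.span (insert b B) \<longleftrightarrow> x \<in> ?U \<or> x \<in> ?f ` ?U" for x
    proof -
      have "x \<in> Z2_fun.span (insert b B) \<longleftrightarrow> x - (\<lambda>i. 0) \<in> ?U \<or> x - b \<in> ?U"
        unfolding Z2_fun.span_insert mem_Collect_eq two[symmetric] by simp
      moreover have "x - (\<lambda>i. 0) = x" by (simp add: fun_eq_iff)
      moreover have "x \<in> ?f ` ?U \<longleftrightarrow> x - b \<in> ?U" by (force simp: image_iff)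
      ultimately show ?thesis by simp
    qed
    then show ?thesis by blast
  qed
  moreover have "?U \<inter> ?f ` ?U = {}"
  proof -
    have "x + b \<notin> ?U" if "x \<in> ?U" for x
      using b Z2_fun.span_diff[of "x + b" B x] that by auto
    then show ?thesis by auto
  qed
  moreover have "card (?f ` ?U) = card ?U" by (rule card_image) (simp add: inj_on_def)
  ultimately show ?case
    using insert.IH[OF ind] insert.hyps by (simp add: card_Un_disjoint)
qed

lemma card_Z2_span:
  fixes V :: "('a \<Rightarrow> bit) set"
  assumes "finite V"
  shows "finite (Z2_fun.span V)" "card (Z2_fun.span V) = 2 ^ Z2_fun.dim V"
proof -
  obtain B where B: "B \<subseteq> V" "Z2_fun.independent B" "V \<subseteq> Z2_fun.span B" "card B = Z2_fun.dim V"
    using Z2_fun.basis_exists by blast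
  then have "Z2_fun.span V = Z2_fun.span B"
    by (metis Z2_fun.span_minimal Z2_fun.span_mono Z2_fun.subspace_span subset_antisym)
  then show "finite (Z2_fun.span V)" "card (Z2_fun.span V) = 2 ^ Z2_fun.dim V"
    using card_Z2_span_independent[of B] B assms finite_subset by metis+
qed

lemma card_Z2_vectors:
  assumes "finite S"
  shows "finite {x :: 'a \<Rightarrow> bit. \<forall>i. i \<notin> S \<longrightarrow> x i = 0}"
    and "card {x :: 'a \<Rightarrow> bit. \<forall>i. i \<notin> S \<longrightarrow> x i = 0} = 2 ^ card S"
proof -
  \<comment> \<open>A vector over the two-element field is determined by its support.\<close>
  have bij: "bij_betw (\<lambda>x :: 'a \<Rightarrow> bit. {i. x i = 1}) {x. \<forall>i. i \<notin> S \<longrightarrow> x i = 0} (Pow S)"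
    by (rule bij_betw_byWitness[where f' = "\<lambda>X i. if i \<in> X then 1 else 0"])
      (auto simp: fun_eq_iff split: if_splits)
  then show "finite {x :: 'a \<Rightarrow> bit. \<forall>i. i \<notin> S \<longrightarrow> x i = 0}"
    and "card {x :: 'a \<Rightarrow> bit. \<forall>i. i \<notin> S \<longrightarrow> x i = 0} = 2 ^ card S"
    using bij_betw_finite[OF bij] bij_betw_same_card[OF bij] assms by (simp_all add: card_Pow)
qed

text \<open>Rank-nullity by counting: the map \<open>\<phi>\<close> has the column span as its
  image, and all its fibres are translates of the kernel.\<close>

lemma card_kernel:
  assumes "finite S"
  shows "card (kernel S M) = 2 ^ corank S M"
proof -
  define E where "E = {x :: 'a \<Rightarrow> bit. \<forall>i. i \<notin> S \<longrightarrow> x i = 0}"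
  define \<phi> where "\<phi> x = (\<lambda>i. if i \<in> S then \<Sum>j\<in>S. M i j * x j else 0)" for x :: "'a \<Rightarrow> bit"
  define V where "V = matrix_column S M ` S"
  have finE: "finite E" and cardE: "card E = 2 ^ card S"
    using card_Z2_vectors[OF assms] by (simp_all add: E_def)
  have add: "\<phi> (x + y) = \<phi> x + \<phi> y" for x y
    by (simp add: \<phi>_def fun_eq_iff algebra_simps sum.distrib)
  have scale: "\<phi> (\<lambda>i. c * x i) = (\<lambda>i. c * \<phi> x i)" for c x
    by (simp add: \<phi>_def fun_eq_iff sum_distrib_left mult.left_commute)
  have addE: "x + y \<in> E" if "x \<in> E" "y \<in> E" for x y using that by (simp add: E_def)
  have \<phi>0: "\<phi> 0 = 0" by (simp add: \<phi>_def fun_eq_iff)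
  have twice: "x + x = 0" for x :: "'a \<Rightarrow> bit" by (simp add: fun_eq_iff)
  have kernel_eq: "kernel S M = {x \<in> E. \<phi> x = 0}"
    by (auto simp: kernel_def E_def \<phi>_def fun_eq_iff)
  have "\<phi> ` E = Z2_fun.span V"
  proof
    have "(\<Sum>j\<in>S. (\<lambda>i. x j * matrix_column S M j i)) \<in> Z2_fun.span V" for x
      by (intro Z2_fun.span_sum Z2_fun.span_scale Z2_fun.span_base) (auto simp: V_def)
    \<comment> \<open>The index set \<open>T\<close> is separated from \<open>S\<close> so that the
      sum of functions can be evaluated by induction while the columns stay fixed.\<close>
    moreover have "(\<Sum>j\<in>T. (\<lambda>i. x j * matrix_column S M j i))
        = (\<lambda>i. if i \<in> S then \<Sum>j\<in>T. M i j * x j else 0)" if "finite T" for x T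
      using that
      by induction (auto simp: fun_eq_iff matrix_column_def mult.commute)
    ultimately have "\<phi> x \<in> Z2_fun.span V" for x using assms by (simp add: \<phi>_def)
    then show "\<phi> ` E \<subseteq> Z2_fun.span V" by blast
  next
    have "V \<subseteq> \<phi> ` E"
    proof
      fix y assume "y \<in> V"
      then obtain k where k: "k \<in> S" "y = matrix_column S M k" by (auto simp: V_def)
      have "y = \<phi> (\<lambda>i. if i = k then 1 else 0)"
        using k assms by (simp add: \<phi>_def fun_eq_iff matrix_column_def if_distrib cong: if_cong)
      then show "y \<in> \<phi> ` E" using k by (auto simp: E_def)
    qed
    moreover have "Z2_fun.subspace (\<phi> ` E)"
      unfolding Z2_fun.subspace_def
    proof (intro conjI ballI allI)
      show "0 \<in> \<phi> ` E" using \<phi>0 by (force simp: E_def)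
      show "x + y \<in> \<phi> ` E" if "x \<in> \<phi> ` E" "y \<in> \<phi> ` E" for x y
        using that add addE by (metis (no_types, lifting) image_iff)
      show "(\<lambda>i. c * x i) \<in> \<phi> ` E" if x: "x \<in> \<phi> ` E" for c x
      proof -
        obtain y where "y \<in> E" "x = \<phi> y" using x by blast
        then show ?thesis
          using scale[of c y] by (intro image_eqI[of _ _ "\<lambda>i. c * y i"]) (auto simp: E_def)
      qed
    qed
    ultimately show "Z2_fun.span V \<subseteq> \<phi> ` E" by (rule Z2_fun.span_minimal)
  qed
  then have card_image: "card (\<phi> ` E) = 2 ^ matrix_rank S M"
    using card_Z2_span[of V] assms by (simp add: V_def matrix_rank_def)
  have fibre: "card {x \<in> E. \<phi> x = \<phi> z} = card (kernel S M)" if "z \<in> E" for z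
  proof (rule bij_betw_same_card)
    show "bij_betw (\<lambda>x. x + z) {x \<in> E. \<phi> x = \<phi> z} (kernel S M)"
      unfolding kernel_eq
      by (rule bij_betw_byWitness[where f' = "\<lambda>x. x + z"])
        (use that addE in \<open>auto simp: add twice add.assoc\<close>)
  qed
  have "card E = (\<Sum>y\<in>\<phi> ` E. card {x \<in> E. \<phi> x = y})"
    using sum.image_gen[OF finE, of "\<lambda>_. 1::nat" \<phi>] by simp
  also have "\<dots> = (\<Sum>y\<in>\<phi> ` E. card (kernel S M))" using fibre by (intro sum.cong) auto
  finally have prod: "2 ^ matrix_rank S M * card (kernel S M) = (2::nat) ^ card S"
    using cardE card_image by simp
  \<comment> \<open>The subtraction in \<open>corank\<close> is truncated, so the rank must be
    bounded by the size.\<close>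
  have "card (\<phi> ` E) \<le> card E" by (rule card_image_le[OF finE])
  then have "matrix_rank S M \<le> card S" using card_image cardE by simp
  then have "(2::nat) ^ card S = 2 ^ matrix_rank S M * 2 ^ corank S M"
    by (simp add: corank_def flip: power_add)
  with prod show ?thesis by simp
qed

text \<open>Maximal corank means that every vector on \<open>S\<close> lies in the kernel, and the
  unit vectors then read off the entries of \<open>M\<close>.\<close>

lemma corank_eq_card_iff:
  assumes "finite S"
  shows "corank S M = card S \<longleftrightarrow> (\<forall>i\<in>S. \<forall>j\<in>S. M i j = 0)"
proof
  let ?E = "{x :: 'a \<Rightarrow> bit. \<forall>i. i \<notin> S \<longrightarrow> x i = 0}"
  have sub: "kernel S M \<subseteq> ?E" by (auto simp: kernel_def)
  {
    assume "corank S M = card S"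
    then have "kernel S M = ?E"
      using card_subset_eq[OF card_Z2_vectors(1)[OF assms] sub] card_Z2_vectors(2)[OF assms]
        card_kernel[OF assms] by simp
    show "\<forall>i\<in>S. \<forall>j\<in>S. M i j = 0"
    proof (intro ballI)
      fix i k assume "i \<in> S" "k \<in> S"
      then have "(\<lambda>j. if j = k then 1 else 0) \<in> kernel S M" using \<open>kernel S M = ?E\<close> by auto
      then show "M i k = 0"
        using \<open>i \<in> S\<close> \<open>k \<in> S\<close> assms by (simp add: kernel_def if_distrib cong: if_cong)
    qed
  }
  assume "\<forall>i\<in>S. \<forall>j\<in>S. M i j = 0"
  then have "kernel S M = ?E" by (auto simp: kernel_def)
  then have "(2::nat) ^ corank S M = 2 ^ card S"
    using card_Z2_vectors(2)[OF assms] card_kernel[OF assms, of M] by simp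
  then show "corank S M = card S" by simp
qed

text \<open>Composition with \<open>f\<close> carries one kernel to the other. Besides isomorphisms
  this serves to rename a single vertex, with \<open>f\<close> of the form
  \<open>id(u := v)\<close>.\<close>

lemma corank_reindex:
  assumes f: "bij_betw f S T" and fin: "finite S"
    and M: "\<And>i j. i \<in> S \<Longrightarrow> j \<in> S \<Longrightarrow> N (f i) (f j) = M i j"
  shows "corank T N = corank S M"
proof -
  have "finite T" using f fin bij_betw_finite by blast
  define g where "g = the_inv_into S f"
  have g: "g (f i) = i" if "i \<in> S" for i
    using f that by (simp add: g_def the_inv_into_f_f bij_betw_def)
  have fg: "f (g i) = i" "g i \<in> S" if "i \<in> T" for i
    using f that by (auto simp: g_def bij_betw_def f_the_inv_into_f the_inv_into_into)
  have fT: "f i \<in> T" if "i \<in> S" for i using f that by (auto simp: bij_betw_def)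
  have sum: "(\<Sum>j\<in>T. N i j * x j) = (\<Sum>j\<in>S. N i (f j) * x (f j))" for i x
    using sum.reindex_bij_betw[OF f, of "\<lambda>j. N i j * x j"] by simp
  have "bij_betw (\<lambda>x i. if i \<in> S then x (f i) else 0) (kernel T N) (kernel S M)"
  proof (rule bij_betw_byWitness[where f' = "\<lambda>x i. if i \<in> T then x (g i) else 0"])
    show "(\<lambda>x i. if i \<in> S then x (f i) else 0) ` kernel T N \<subseteq> kernel S M"
    proof (clarsimp simp: kernel_def sum)
      fix x i assume "\<forall>i\<in>T. (\<Sum>j\<in>S. N i (f j) * x (f j)) = 0" "i \<in> S"
      then have "(\<Sum>j\<in>S. N (f i) (f j) * x (f j)) = 0" using fT by blast
      then show "(\<Sum>j\<in>S. M i j * x (f j)) = 0" using M \<open>i \<in> S\<close> by simp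
    qed
    show "(\<lambda>x i. if i \<in> T then x (g i) else 0) ` kernel S M \<subseteq> kernel T N"
    proof (clarsimp simp: kernel_def sum fT g)
      fix x i assume "\<forall>i\<in>S. (\<Sum>j\<in>S. M i j * x j) = 0" "i \<in> T"
      then have "(\<Sum>j\<in>S. M (g i) j * x j) = 0" using fg by blast
      moreover have "N i (f j) = M (g i) j" if "j \<in> S" for j
        using M[of "g i" j] fg[OF \<open>i \<in> T\<close>] that by simp
      ultimately show "(\<Sum>j\<in>S. N i (f j) * x j) = 0" by simp
    qed
  qed (auto simp: kernel_def fun_eq_iff fg g fT)
  then have "(2::nat) ^ corank T N = 2 ^ corank S M"
    using card_kernel[OF fin, of M] card_kernel[OF \<open>finite T\<close>, of N]
    by (simp add: bij_betw_same_card)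
  then show ?thesis by simp
qed

lemma corank_cong:
  assumes "finite S" "\<And>i j. i \<in> S \<Longrightarrow> j \<in> S \<Longrightarrow> M i j = N i j"
  shows "corank S M = corank S N"
  using corank_reindex[of id S S M N] assms by simp

section \<open>Coranks under row and column operations\<close>

lemma card_Z2: "card (UNIV :: bit set) = 2"
proof -
  have "(UNIV :: bit set) = {0, 1}" by auto
  then show ?thesis by (metis card_2_iff zero_neq_one)
qed

lemma Z2_add_eq_0_iff: "a + b = 0 \<longleftrightarrow> a = b" for a b :: bit
  by (cases a; cases b) simp_all

text \<open>The equation of row \<open>v\<close> follows from the others. By symmetry column
  \<open>v\<close> is the same combination of columns, so the coordinate \<open>x v\<close> can be
  absorbed into those on \<open>S\<close> and is itself free, which doubles the kernel.\<close>

lemma corank_insert_dependent: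
  assumes fin: "finite S" and v: "v \<notin> S"
    and sym: "\<And>i. i \<in> S \<Longrightarrow> M i v = M v i" "\<And>i j. i \<in> S \<Longrightarrow> j \<in> S \<Longrightarrow> M i j = M j i"
    and dep: "\<And>j. j \<in> insert v S \<Longrightarrow> M v j = (\<Sum>w\<in>S. c w * M w j)"
  shows "corank (insert v S) M = Suc (corank S M)"
proof -
  have row: "(\<Sum>j\<in>S. M i j * x j) + M i v * t = (\<Sum>j\<in>S. M i j * (x j + c j * t))"
    if "i \<in> S" for i x t
  proof -
    have "M i v = (\<Sum>w\<in>S. M i w * c w)"
      using sym dep[of i] that by (simp add: mult.commute)
    then show ?thesis by (simp add: algebra_simps sum.distrib sum_distrib_left)
  qed
  have row_v: "(\<Sum>j\<in>S. M v j * x j) + M v v * t = 0"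
    if "\<forall>i\<in>S. (\<Sum>j\<in>S. M i j * x j) + M i v * t = 0" for x t
  proof -
    have "(\<Sum>j\<in>S. M v j * x j) = (\<Sum>j\<in>S. \<Sum>w\<in>S. c w * (M w j * x j))"
      by (rule sum.cong) (simp_all add: dep sum_distrib_right mult.assoc)
    also have "\<dots> = (\<Sum>w\<in>S. c w * (\<Sum>j\<in>S. M w j * x j))"
      by (subst sum.swap) (simp add: sum_distrib_left)
    finally have "(\<Sum>j\<in>S. M v j * x j) + M v v * t
        = (\<Sum>w\<in>S. c w * ((\<Sum>j\<in>S. M w j * x j) + M w v * t))"
      using dep[of v]
      by (simp add: sum_distrib_right sum.distrib distrib_left mult.assoc)
    then show ?thesis using that by simp
  qed
  have ker: "kernel (insert v S) M = {x. (\<forall>i. i \<notin> insert v S \<longrightarrow> x i = 0) \<and>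
      (\<forall>i\<in>S. (\<Sum>j\<in>S. M i j * (x j + c j * x v)) = 0)}"
    using row_v v fin by (auto simp: kernel_def row[symmetric] add.commute)
  have "bij_betw (\<lambda>x. (\<lambda>i. if i \<in> S then x i + c i * x v else 0, x v))
      (kernel (insert v S) M) (kernel S M \<times> UNIV)"
  proof (rule bij_betw_byWitness[where
      f' = "\<lambda>(y, t) i. if i \<in> S then y i + c i * t else if i = v then t else 0"])
  qed (auto simp: ker, auto simp: kernel_def fun_eq_iff v add.assoc cong: sum.cong)
  then have "card (kernel (insert v S) M) = 2 * card (kernel S M)"
    by (simp add: bij_betw_same_card card_cartesian_product card_Z2)
  then have "(2::nat) ^ corank (insert v S) M = 2 ^ Suc (corank S M)"
    using fin by (simp add: card_kernel)
  then show ?thesis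
    using power_inject_exp[of "2::nat" "corank (insert v S) M" "Suc (corank S M)"] by simp
qed

text \<open>\<open>N\<close> is the Schur complement of the block of \<open>M\<close> on \<open>{u, v}\<close>.\<close>

lemma corank_pivot:
  assumes fin: "finite S" and uv: "u \<notin> S" "v \<notin> S" "u \<noteq> v"
    and M: "M u u = 0" "M v v = 0" "M u v = 1" "M v u = 1"
    and N: "\<And>i j. i \<in> S \<Longrightarrow> j \<in> S \<Longrightarrow> N i j = M i j + M i u * M v j + M i v * M u j"
  shows "corank (insert u (insert v S)) M = corank S N"
proof -
  have neq: "j \<noteq> u" "j \<noteq> v" if "j \<in> S" for j using uv that by auto
  \<comment> \<open>The pivot block has zero diagonal and ones off it: row \<open>u\<close> solves
    for \<open>x v\<close> and row \<open>v\<close> for \<open>x u\<close>. Substituting both into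
    the remaining rows gives \<open>N\<close>.\<close>
  have ker: "kernel (insert u (insert v S)) M = {x.
      (\<forall>i. i \<notin> insert u (insert v S) \<longrightarrow> x i = 0) \<and> x v = (\<Sum>j\<in>S. M u j * x j)
      \<and> x u = (\<Sum>j\<in>S. M v j * x j)
      \<and> (\<forall>i\<in>S. (\<Sum>j\<in>S. M i j * x j) + M i u * x u + M i v * x v = 0)}"
    using uv fin M by (auto simp: kernel_def Z2_add_eq_0_iff ac_simps)
  have row: "(\<Sum>j\<in>S. N i j * x j) = (\<Sum>j\<in>S. M i j * x j) + M i u * (\<Sum>j\<in>S. M v j * x j)
      + M i v * (\<Sum>j\<in>S. M u j * x j)" if "i \<in> S" for i x
    using that by (simp add: N algebra_simps sum.distrib sum_distrib_left)
  have "bij_betw (\<lambda>x. x(u := 0, v := 0)) (kernel (insert u (insert v S)) M) (kernel S N)"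
  proof (rule bij_betw_byWitness[where
      f' = "\<lambda>x. x(u := \<Sum>j\<in>S. M v j * x j, v := \<Sum>j\<in>S. M u j * x j)"])
    have upd: "(\<Sum>j\<in>S. f j * (if j = v then b else if j = u then a else x j)) = (\<Sum>j\<in>S. f j * x j)"
      for f x a b by (rule sum.cong) (auto simp: neq)
    show "(\<lambda>x. x(u := 0, v := 0)) ` kernel (insert u (insert v S)) M \<subseteq> kernel S N"
      unfolding image_subset_iff ker by (auto simp: kernel_def fun_upd_def upd row)
    show "(\<lambda>x. x(u := \<Sum>j\<in>S. M v j * x j, v := \<Sum>j\<in>S. M u j * x j)) ` kernel S N
        \<subseteq> kernel (insert u (insert v S)) M"
      unfolding image_subset_iff ker by (auto simp: kernel_def fun_upd_def upd row neq)
    show "\<forall>x\<in>kernel (insert u (insert v S)) M. (x(u := 0, v := 0))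
        (u := \<Sum>j\<in>S. M v j * (x(u := 0, v := 0)) j, v := \<Sum>j\<in>S. M u j * (x(u := 0, v := 0)) j) = x"
      unfolding ker by (auto simp: fun_eq_iff fun_upd_def upd)
    show "\<forall>x\<in>kernel S N. x
        (u := \<Sum>j\<in>S. M v j * x j, v := \<Sum>j\<in>S. M u j * x j, u := 0, v := 0) = x"
      using uv by (auto simp: fun_eq_iff kernel_def)
  qed
  then have "(2::nat) ^ corank (insert u (insert v S)) M = 2 ^ corank S N"
    using card_kernel[of "insert u (insert v S)" M] card_kernel[OF fin, of N] fin
      bij_betw_same_card by fastforce
  then show ?thesis by simp
qed

text \<open>Multiples of row \<open>u\<close> are added to the rows in \<open>S\<close> and multiples of column \<open>u\<close> to the columns.\<close>

lemma corank_add_row_col: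
  assumes fin: "finite S" and u: "u \<notin> S"
    and M: "M u u = 0"
    and N: "N u u = 0" "\<And>i. i \<in> S \<Longrightarrow> N i u = M i u" "\<And>i. i \<in> S \<Longrightarrow> N u i = M u i"
      "\<And>i j. i \<in> S \<Longrightarrow> j \<in> S \<Longrightarrow> N i j = M i j + M i u * a j + b i * M u j"
  shows "corank (insert u S) N = corank (insert u S) M"
proof -
  have ker: "kernel (insert u S) L = {x. (\<forall>i. i \<notin> insert u S \<longrightarrow> x i = 0) \<and>
      (\<Sum>j\<in>S. L u j * x j) = 0 \<and> (\<forall>i\<in>S. (\<Sum>j\<in>S. L i j * x j) + L i u * x u = 0)}"
    if "L u u = 0" for L
    using u fin that by (auto simp: kernel_def ac_simps)
  have row: "(\<Sum>j\<in>S. N i j * x j) = (\<Sum>j\<in>S. M i j * x j) + M i u * (\<Sum>j\<in>S. a j * x j)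
      + b i * (\<Sum>j\<in>S. M u j * x j)" if "i \<in> S" for i x
    using that by (simp add: N algebra_simps sum.distrib sum_distrib_left)
  have upd: "(\<Sum>j\<in>S. f j * (x(u := t)) j) = (\<Sum>j\<in>S. f j * x j)" "(x(u := t)) u = t" for f x t
    using u by (auto intro: sum.cong)
  \<comment> \<open>The multiples of column \<open>u\<close> are absorbed by the coordinate at
    \<open>u\<close>, and the multiples of row \<open>u\<close> vanish on the kernel. The added sum
    does not involve that coordinate, so the map is its own inverse in characteristic 2.\<close>
  let ?f = "\<lambda>x. x(u := x u + (\<Sum>j\<in>S. a j * x j))"
  have "bij_betw ?f (kernel (insert u S) N) (kernel (insert u S) M)"
  proof (rule bij_betw_byWitness[where f' = ?f])
    show "?f ` kernel (insert u S) N \<subseteq> kernel (insert u S) M"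
      unfolding image_subset_iff ker[of M, OF M] ker[of N, OF N(1)]
      by (simp add: upd N(2,3) row distrib_left del: fun_upd_apply) (auto simp: ac_simps)
    show "?f ` kernel (insert u S) M \<subseteq> kernel (insert u S) N"
      unfolding image_subset_iff ker[of M, OF M] ker[of N, OF N(1)]
      by (simp add: upd N(2,3) row distrib_left del: fun_upd_apply) (auto simp: ac_simps)
  qed (simp_all add: upd add.assoc del: fun_upd_apply)
  then have "(2::nat) ^ corank (insert u S) N = 2 ^ corank (insert u S) M"
    using card_kernel[of "insert u S" M] card_kernel[of "insert u S" N] fin
      bij_betw_same_card by fastforce
  then show ?thesis by simp
qed

section \<open>The Kauffman bracket\<close>

text \<open>
  The weight is \<open>a\<close> if the state agrees at the vertex with the \<open>A\<close>-state, and \<open>1/a\<close> if it agrees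
  with the \<open>B\<close>-state.
\<close>

definition smoothing_weight :: "real \<Rightarrow> sign \<Rightarrow> bool \<Rightarrow> real" where
  "smoothing_weight a l b = (if b = (l = Minus) then a else inverse a)"

text \<open>The factor \<open>g\<close> is arbitrary so that vertices can be split off one after
  another, each split replacing \<open>g\<close> by a combination of two of its values.\<close>

definition state_sum :: "real \<Rightarrow> ('a \<Rightarrow> sign) \<Rightarrow> 'a set \<Rightarrow> ('a set \<Rightarrow> real) \<Rightarrow> real" where
  "state_sum a l V g = (\<Sum>s\<in>Pow V. (\<Prod>v\<in>V. smoothing_weight a (l v) (v \<in> s)) * g s)"

definition loop_value :: "real \<Rightarrow> real" where
  "loop_value a = - (a ^ 2) - inverse a ^ 2"

text \<open>The exponent is the number of circles minus one, which gives the empty graph the value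
  1. As \<open>corank s\<close> reads only entries on \<open>s\<close>, the matrix of
  \<open>G\<close> can stand for that of \<open>induced G s\<close>.\<close>

definition bracket :: "'a lgraph \<Rightarrow> real \<Rightarrow> real" where
  "bracket G a = state_sum a (lab G) (verts G) (\<lambda>s. loop_value a ^ corank s (adj_matrix G))"

text \<open>The skein expansion at \<open>u\<close>: states come in pairs \<open>s\<close>,
  \<open>insert u s\<close>, on which the weights of all other vertices agree.\<close>

lemma state_sum_insert:
  assumes "finite V" "u \<notin> V"
  shows "state_sum a l (insert u V) g =
    state_sum a l V (\<lambda>s. smoothing_weight a (l u) False * g s
      + smoothing_weight a (l u) True * g (insert u s))"
proof -
  have neq: "v \<noteq> u" if "v \<in> V" for v using that assms by auto
  have inj: "inj_on (insert u) (Pow V)" using assms by (auto simp: inj_on_def)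
  have "state_sum a l (insert u V) g =
      (\<Sum>s\<in>Pow V. (\<Prod>v\<in>insert u V. smoothing_weight a (l v) (v \<in> s)) * g s)
      + (\<Sum>s\<in>Pow V. (\<Prod>v\<in>insert u V. smoothing_weight a (l v) (v \<in> insert u s)) * g (insert u s))"
    using assms unfolding state_sum_def Pow_insert
    by (subst sum.union_disjoint) (auto simp: sum.reindex[OF inj])
  also have "\<dots> = (\<Sum>s\<in>Pow V. (\<Prod>v\<in>V. smoothing_weight a (l v) (v \<in> s)) *
      (smoothing_weight a (l u) False * g s + smoothing_weight a (l u) True * g (insert u s)))"
    unfolding sum.distrib[symmetric]
  proof (rule sum.cong)
    fix s assume "s \<in> Pow V"
    then have "u \<notin> s" using assms by auto
    have "(\<Prod>v\<in>V. smoothing_weight a (l v) (v \<in> insert u s))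
        = (\<Prod>v\<in>V. smoothing_weight a (l v) (v \<in> s))"
      by (rule prod.cong) (simp_all add: neq)
    with \<open>u \<notin> s\<close> assms
    show "(\<Prod>v\<in>insert u V. smoothing_weight a (l v) (v \<in> s)) * g s
      + (\<Prod>v\<in>insert u V. smoothing_weight a (l v) (v \<in> insert u s)) * g (insert u s)
      = (\<Prod>v\<in>V. smoothing_weight a (l v) (v \<in> s)) *
      (smoothing_weight a (l u) False * g s + smoothing_weight a (l u) True * g (insert u s))"
      by (simp add: algebra_simps)
  qed simp
  finally show ?thesis by (simp add: state_sum_def)
qed

lemma state_sum_cong:
  assumes "\<And>v. v \<in> V \<Longrightarrow> l v = l' v" "\<And>s. s \<subseteq> V \<Longrightarrow> g s = h s"
  shows "state_sum a l V g = state_sum a l' V h"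
  using assms unfolding state_sum_def by (intro sum.cong arg_cong2[of _ _ _ _ "(*)"] prod.cong) auto

lemma state_sum_scale: "state_sum a l V (\<lambda>s. c * g s) = c * state_sum a l V g"
  by (simp add: state_sum_def sum_distrib_left mult.left_commute)

lemma state_sum_reindex:
  assumes f: "bij_betw f V W" and l: "\<And>v. v \<in> V \<Longrightarrow> l' (f v) = l v"
  shows "state_sum a l' W g = state_sum a l V (\<lambda>s. g (f ` s))"
proof -
  have "state_sum a l' W g
      = (\<Sum>s\<in>Pow V. (\<Prod>v\<in>W. smoothing_weight a (l' v) (v \<in> f ` s)) * g (f ` s))"
    unfolding state_sum_def
    using sum.reindex_bij_betw[OF bij_betw_Pow[OF f],
      of "\<lambda>s. (\<Prod>v\<in>W. smoothing_weight a (l' v) (v \<in> s)) * g s"] by simp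
  also have "\<dots> = state_sum a l V (\<lambda>s. g (f ` s))"
    unfolding state_sum_def
  proof (intro sum.cong refl arg_cong2[of _ _ _ _ "(*)"])
    fix s assume "s \<in> Pow V"
    then have "f v \<in> f ` s \<longleftrightarrow> v \<in> s" if "v \<in> V" for v
      using f that by (auto simp: bij_betw_def inj_on_def)
    then show "(\<Prod>v\<in>W. smoothing_weight a (l' v) (v \<in> f ` s))
        = (\<Prod>v\<in>V. smoothing_weight a (l v) (v \<in> s))"
      using l prod.reindex_bij_betw[OF f, of "\<lambda>v. smoothing_weight a (l' v) (v \<in> f ` s)"]
      by (simp cong: prod.cong)
  qed
  finally show ?thesis .
qed

lemma adj_matrix_simps:
  assumes "labeled_graph G"
  shows "adj_matrix G u u = 0" and "adj_matrix G u v = adj_matrix G v u"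
  using assms by (auto simp: adj_matrix_def labeled_graph_def)

section \<open>Invariance under the moves\<close>

lemma bracket_isomorphic:
  assumes G: "labeled_graph G" and "isomorphic G H"
  shows "bracket H a = bracket G a"
proof -
  obtain f where f: "bij_betw f (verts G) (verts H)"
    and adj: "\<And>u v. u \<in> verts G \<Longrightarrow> v \<in> verts G \<Longrightarrow> adj H (f u) (f v) \<longleftrightarrow> adj G u v"
    and lab: "\<And>v. v \<in> verts G \<Longrightarrow> lab H (f v) = lab G v"
    using assms by (auto simp: isomorphic_def)
  have fin: "finite (verts G)" using G by (simp add: labeled_graph_def)
  have "corank (f ` s) (adj_matrix H) = corank s (adj_matrix G)" if s: "s \<subseteq> verts G" for s
  proof (rule corank_reindex)
    show "bij_betw f s (f ` s)" using f s by (auto simp: bij_betw_def inj_on_subset)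
    show "finite s" using fin s by (rule finite_subset[rotated])
    show "adj_matrix H (f i) (f j) = adj_matrix G i j" if "i \<in> s" "j \<in> s" for i j
      using that s adj by (auto simp: adj_matrix_def)
  qed
  then have "state_sum a (lab G) (verts G) (\<lambda>s. loop_value a ^ corank (f ` s) (adj_matrix H))
      = bracket G a"
    unfolding bracket_def by (intro state_sum_cong) auto
  then show ?thesis
    using state_sum_reindex[of f "verts G" "verts H" "lab H" "lab G" a] f lab
    by (simp add: bracket_def)
qed

lemma bracket_induced:
  assumes "labeled_graph G" "W \<subseteq> verts G"
  shows "bracket (induced G W) a
    = state_sum a (lab G) W (\<lambda>s. loop_value a ^ corank s (adj_matrix G))"
proof -
  have "verts (induced G W) = W" "lab (induced G W) = lab G" by (simp_all add: induced_def)
  moreover have "corank s (adj_matrix (induced G W)) = corank s (adj_matrix G)" if "s \<subseteq> W" for s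
  proof (rule corank_cong)
    show "finite s"
      using assms that by (auto simp: labeled_graph_def intro: finite_subset)
  qed (use that in \<open>auto simp: adj_matrix_def induced_def\<close>)
  ultimately show ?thesis unfolding bracket_def by (auto intro: state_sum_cong)
qed

text \<open>The row of \<open>v\<close> is zero, so adding \<open>v\<close> to a state raises the
  corank by one and contributes a factor \<open>loop_value a\<close>.\<close>

lemma bracket_omega1:
  assumes G: "labeled_graph G" and v: "isolated G v"
  shows "bracket G a = (smoothing_weight a (lab G v) False
    + smoothing_weight a (lab G v) True * loop_value a) * bracket (induced G (verts G - {v})) a"
proof -
  define W where "W = verts G - {v}"
  have V: "verts G = insert v W" "v \<notin> W" "finite W" "W \<subseteq> verts G"
    using v G by (auto simp: W_def isolated_def labeled_graph_def)
  have "corank (insert v s) (adj_matrix G) = Suc (corank s (adj_matrix G))" if "s \<subseteq> W" for s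
  proof (rule corank_insert_dependent)
    show "finite s" "v \<notin> s" using V that finite_subset by auto
    show "adj_matrix G v j = (\<Sum>w\<in>s. 0 * adj_matrix G w j)" for j
      using v G by (auto simp: adj_matrix_def isolated_def nbhd_def labeled_graph_def)
  qed (rule adj_matrix_simps[OF G])+
  then have "bracket G a = state_sum a (lab G) W (\<lambda>s. (smoothing_weight a (lab G v) False
      + smoothing_weight a (lab G v) True * loop_value a) * loop_value a ^ corank s (adj_matrix G))"
    unfolding bracket_def V(1) state_sum_insert[OF V(3,2)]
    by (intro state_sum_cong) (auto simp: algebra_simps)
  then show ?thesis
    unfolding state_sum_scale bracket_induced[OF G V(4), folded W_def] W_def[symmetric] .
qed

text \<open>Exchanging the twins shows that states with either one have equal coranks; a state with
  both repeats a row and has corank one larger. Because the labels differ, the weights at the twins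
  are \<open>a ^ 2\<close> and \<open>inverse a ^ 2\<close> for one twin and 1 for none or both. So
  \<open>loop_value a\<close> cancels everything except the states without twins.\<close>

lemma bracket_omega2:
  assumes G: "labeled_graph G" and uv: "u \<in> verts G" "v \<in> verts G" "u \<noteq> v" "\<not> adj G u v"
    "lab G u \<noteq> lab G v" and twins: "\<forall>t\<in>verts G - {u, v}. adj G u t \<longleftrightarrow> adj G v t"
    and a: "a \<noteq> 0"
  shows "bracket G a = bracket (induced G (verts G - {u, v})) a"
proof -
  define W where "W = verts G - {u, v}"
  have V: "verts G = insert u (insert v W)" "u \<notin> insert v W" "v \<notin> W" "finite W" "W \<subseteq> verts G"
    using uv G by (auto simp: W_def labeled_graph_def)
  let ?M = "adj_matrix G"
  note sym = adj_matrix_simps[OF G]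
  have vu: "?M v u = 0" "?M u v = 0" using uv G by (auto simp: adj_matrix_def labeled_graph_def)
  have tw: "?M u t = ?M v t" if "t \<in> W" for t using that twins by (simp add: W_def adj_matrix_def)
  have cv: "corank (insert v s) ?M = corank (insert u s) ?M" if "s \<subseteq> W" for s
  proof (rule corank_reindex)
    have "u \<notin> s" "v \<notin> s" using that V by auto
    then show "bij_betw (id(u := v)) (insert u s) (insert v s)"
      by (auto simp: bij_betw_def inj_on_def)
    show "finite (insert u s)" using that V finite_subset by auto
    show "?M ((id(u := v)) i) ((id(u := v)) j) = ?M i j"
      if "i \<in> insert u s" "j \<in> insert u s" for i j
    proof -
      have "k = u \<or> k \<noteq> u \<and> k \<in> W" if "k \<in> insert u s" for k
        using that \<open>s \<subseteq> W\<close> \<open>u \<notin> s\<close> by auto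
      then show ?thesis using that tw sym(1) sym(2)[of _ u] sym(2)[of _ v]
        by (metis fun_upd_apply id_apply)
    qed
  qed
  have cuv: "corank (insert u (insert v s)) ?M = Suc (corank (insert u s) ?M)" if "s \<subseteq> W" for s
  proof -
    have fin: "finite s" "u \<notin> s" "v \<notin> s" using that V finite_subset by auto
    have "corank (insert v (insert u s)) ?M = Suc (corank (insert u s) ?M)"
    proof (rule corank_insert_dependent)
      show "finite (insert u s)" "v \<notin> insert u s" using fin uv by auto
      show "?M v j = (\<Sum>w\<in>insert u s. (if w = u then 1 else 0) * ?M w j)"
        if "j \<in> insert v (insert u s)" for j
      proof -
        have "(\<Sum>w\<in>insert u s. (if w = u then 1 else 0) * ?M w j) = ?M u j"
          using fin by (simp add: if_distrib[of "\<lambda>x. x * _"] cong: if_cong)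
        then show ?thesis using that tw \<open>s \<subseteq> W\<close> vu sym(1) by auto
      qed
    qed (rule sym)+
    then show ?thesis by (simp add: insert_commute)
  qed
  have "bracket G a = state_sum a (lab G) W (\<lambda>s. loop_value a ^ corank s ?M)"
    unfolding bracket_def V(1)
      state_sum_insert[OF finite_insert[THEN iffD2, OF V(4)] V(2)] state_sum_insert[OF V(4,3)]
  proof (rule state_sum_cong)
    fix s assume "s \<subseteq> W"
    then show "smoothing_weight a (lab G v) False * (smoothing_weight a (lab G u) False *
            loop_value a ^ corank s ?M + smoothing_weight a (lab G u) True *
            loop_value a ^ corank (insert u s) ?M)
        + smoothing_weight a (lab G v) True * (smoothing_weight a (lab G u) False *
            loop_value a ^ corank (insert v s) ?M + smoothing_weight a (lab G u) True *
            loop_value a ^ corank (insert u (insert v s)) ?M)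
        = loop_value a ^ corank s ?M"
      using a uv by (cases "lab G u"; cases "lab G v")
        (simp_all add: cv cuv smoothing_weight_def loop_value_def field_simps power2_eq_square)
  qed simp
  then show ?thesis unfolding bracket_induced[OF G V(5), folded W_def] W_def[symmetric] .
qed

text \<open>Away from \<open>u\<close> and \<open>v\<close> the move is the Schur complement at
  \<open>{u, v}\<close>. Hence states containing both vertices and states containing neither
  exchange their coranks, while with exactly one of them the change is a row and column operation.
  The new labels permute the weights in the same way.\<close>

lemma bracket_omega4:
  assumes G: "labeled_graph G" and uv: "u \<in> verts G" "v \<in> verts G" "adj G u v"
  defines "H \<equiv> relabel ((lab G)(u := opposite (lab G v), v := opposite (lab G u)))
    (toggle (omega4_pairs G u v) G)"
  shows "bracket H a = bracket G a"
proof -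
  define W where "W = verts G - {u, v}"
  let ?M = "adj_matrix G" and ?N = "adj_matrix H"
  have "u \<noteq> v" using G uv by (auto simp: labeled_graph_def)
  then have V: "verts G = insert u (insert v W)" "u \<notin> insert v W" "v \<notin> W" "finite W"
    using uv G by (auto simp: W_def labeled_graph_def)
  have adjH: "adj H x y \<longleftrightarrow> ({x, y} \<in> omega4_pairs G u v) \<noteq> adj G x y" for x y
    by (auto simp: H_def relabel_def toggle_def)
  have pairs: "{x, y} \<in> omega4_pairs G u v \<longleftrightarrow> x \<notin> {u, v} \<and> y \<notin> {u, v} \<and>
      (x \<in> nbhd G u \<and> y \<in> nbhd G v - nbhd G u \<or> x \<in> nbhd G v \<and> y \<in> nbhd G u - nbhd G v \<or>
       y \<in> nbhd G u \<and> x \<in> nbhd G v - nbhd G u \<or> y \<in> nbhd G v \<and> x \<in> nbhd G u - nbhd G v)"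
    for x y
    unfolding omega4_pairs_def by (auto simp: doubleton_eq_iff)
  have nbhd: "y \<in> nbhd G x \<longleftrightarrow> adj G x y" for x y
    using G by (auto simp: nbhd_def labeled_graph_def)
  have sym: "adj G x y \<longleftrightarrow> adj G y x" for x y using G by (auto simp: labeled_graph_def)
  have N_pivot: "?N x y = ?M x y" if "x \<in> {u, v} \<or> y \<in> {u, v}" for x y
    using that by (auto simp: adj_matrix_def adjH pairs)
  have N: "?N i j = ?M i j + ?M i u * ?M v j + ?M i v * ?M u j" if "i \<in> W" "j \<in> W" for i j
    using that sym[of i u] sym[of i v] by (auto simp: adj_matrix_def adjH pairs nbhd W_def)
  note M_simps = adj_matrix_simps[OF G]
  have M1: "?M u v = 1" "?M v u = 1" using uv sym by (auto simp: adj_matrix_def)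
  have coranks: "corank (insert u (insert v s)) ?M = corank s ?N"
    "corank (insert u (insert v s)) ?N = corank s ?M"
    "corank (insert u s) ?N = corank (insert u s) ?M"
    "corank (insert v s) ?N = corank (insert v s) ?M" if "s \<subseteq> W" for s
  proof -
    have fin: "finite s" and nin: "u \<notin> s" "v \<notin> s" using V that finite_subset by auto
    show "corank (insert u (insert v s)) ?M = corank s ?N"
      by (rule corank_pivot[OF fin nin \<open>u \<noteq> v\<close>]) (use that in \<open>auto simp: M_simps(1) M1 intro!: N\<close>)
    \<comment> \<open>The rows at \<open>u\<close> and \<open>v\<close> are unchanged, so in
      characteristic 2 a second Schur complement restores \<open>?M\<close>.\<close>
    show "corank (insert u (insert v s)) ?N = corank s ?M"
      by (rule corank_pivot[OF fin nin \<open>u \<noteq> v\<close>])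
        (use that in \<open>auto simp: M_simps(1) M1 N_pivot N subset_iff ac_simps\<close>)
    show "corank (insert u s) ?N = corank (insert u s) ?M"
      by (rule corank_add_row_col[OF fin nin(1), where a = "?M v" and b = "\<lambda>i. ?M i v"])
        (use that in \<open>auto simp: M_simps(1) N_pivot N subset_iff ac_simps\<close>)
    show "corank (insert v s) ?N = corank (insert v s) ?M"
      by (rule corank_add_row_col[OF fin nin(2), where a = "?M u" and b = "\<lambda>i. ?M i u"])
        (use that in \<open>auto simp: M_simps(1) N_pivot N subset_iff ac_simps\<close>)
  qed
  have H: "verts H = insert u (insert v W)" "\<And>x. x \<in> W \<Longrightarrow> lab H x = lab G x"
    "lab H u = opposite (lab G v)" "lab H v = opposite (lab G u)"
    using V \<open>u \<noteq> v\<close> by (auto simp: H_def relabel_def toggle_def)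
  show ?thesis
    unfolding bracket_def H(1) V(1)
      state_sum_insert[OF finite_insert[THEN iffD2, OF V(4)] V(2)] state_sum_insert[OF V(4,3)]
    by (intro state_sum_cong)
      (cases "lab G u"; cases "lab G v";
        simp add: H coranks smoothing_weight_def algebra_simps)+
qed

text \<open>For each state \<open>s\<close> avoiding the three vertices, the eight extensions of
  \<open>s\<close> in \<open>G\<close> and the eight in \<open>H\<close> involve only five
  independent coranks, and the two weighted sums agree by the identity
  \<open>balance\<close>.\<close>

lemma bracket_omega3:
  assumes G: "labeled_graph G" and uvw: "u \<in> verts G" "v \<in> verts G" "w \<in> verts G"
    "u \<noteq> v" "u \<noteq> w" "v \<noteq> w" "lab G u = Minus" "lab G v = Minus" "lab G w = Minus"
    "\<not> adj G v w" and nbhd_u: "nbhd G u = {v, w}" and a: "a \<noteq> 0"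
  defines "H \<equiv> relabel ((lab G)(v := Plus, w := Plus)) (toggle (omega3_pairs G u v w) G)"
  shows "bracket H a = bracket G a"
proof -
  define W where "W = verts G - {u, v, w}"
  let ?M = "adj_matrix G" and ?N = "adj_matrix H"
  have V: "verts G = insert u (insert v (insert w W))" "u \<notin> insert v (insert w W)"
    "v \<notin> insert w W" "w \<notin> W" "finite W"
    using uvw G by (auto simp: W_def labeled_graph_def)
  have nbhd: "y \<in> nbhd G x \<longleftrightarrow> adj G x y" for x y
    using G by (auto simp: nbhd_def labeled_graph_def)
  have sym: "adj G x y \<longleftrightarrow> adj G y x" for x y using G by (auto simp: labeled_graph_def)
  have irr: "\<not> adj G x x" for x using G by (auto simp: labeled_graph_def)
  have adj_u: "adj G u y \<longleftrightarrow> y = v \<or> y = w" for y using nbhd_u nbhd by blast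
  have adjH: "adj H x y \<longleftrightarrow> ({x, y} \<in> omega3_pairs G u v w) \<noteq> adj G x y" for x y
    by (auto simp: H_def relabel_def toggle_def)
  have pairs_u: "{u, y} \<in> omega3_pairs G u v w \<longleftrightarrow> y = v \<or> y = w \<or> adj G v y \<noteq> adj G w y"
    "{y, u} \<in> omega3_pairs G u v w \<longleftrightarrow> y = v \<or> y = w \<or> adj G v y \<noteq> adj G w y" for y
    unfolding omega3_pairs_def by (auto simp: doubleton_eq_iff nbhd)
  have pairs: "{x, y} \<notin> omega3_pairs G u v w" if "x \<noteq> u" "y \<noteq> u" for x y
    using that unfolding omega3_pairs_def by (auto simp: doubleton_eq_iff)
  have N: "?N x y = ?M x y" if "x \<noteq> u" "y \<noteq> u" for x y
    using that by (simp add: adj_matrix_def adjH pairs)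
  \<comment> \<open>The move deletes the old edges at \<open>u\<close> and joins \<open>u\<close> to
    the symmetric difference of two neighbourhoods, so row \<open>u\<close> becomes the sum of rows
    \<open>v\<close> and \<open>w\<close>.\<close>
  have N_u: "?N u y = ?M v y + ?M w y" "?N y u = ?M v y + ?M w y" if "y \<noteq> u" for y
    using that uvw(4-6,10) adj_u sym[of w v] sym[of y u] irr
    by (auto simp: adj_matrix_def adjH pairs_u)
  have N_uu: "?N u u = 0"
    using uvw(4,5) adj_u[of v] adj_u[of w] sym[of u v] sym[of u w] pairs_u(1)[of u] irr[of u]
    by (simp add: adj_matrix_def adjH)
  note M_simps = adj_matrix_simps[OF G]
  have M_u: "?M u v = 1" "?M v u = 1" "?M u w = 1" "?M w u = 1" "?M v w = 0" "?M w v = 0"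
    using adj_u uvw sym[of v u] sym[of w u] sym[of w v] by (auto simp: adj_matrix_def)
  have M_uW: "?M u y = 0" "?M y u = 0" if "y \<in> W" for y
    using that adj_u[of y] sym[of y u] by (auto simp: adj_matrix_def W_def)
  have N_sym: "?N x y = ?N y x" for x y
    by (cases "x = u"; cases "y = u") (simp_all add: N N_u M_simps(2)[of x y])
  have coranks: "corank (insert u s) ?M = Suc (corank s ?M)"
    "corank (insert u (insert v s)) ?M = corank s ?M"
    "corank (insert u (insert w s)) ?M = corank s ?M"
    "corank (insert u (insert v (insert w s))) ?M = corank (insert u s) ?N"
    "corank s ?N = corank s ?M"
    "corank (insert v s) ?N = corank (insert v s) ?M"
    "corank (insert w s) ?N = corank (insert w s) ?M"
    "corank (insert v (insert w s)) ?N = corank (insert v (insert w s)) ?M"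
    "corank (insert u (insert v s)) ?N = corank (insert v (insert w s)) ?M"
    "corank (insert u (insert w s)) ?N = corank (insert v (insert w s)) ?M"
    "corank (insert u (insert v (insert w s))) ?N = Suc (corank (insert v (insert w s)) ?M)"
    if s: "s \<subseteq> W" for s
  proof -
    have fin: "finite s" and nin: "u \<notin> s" "v \<notin> s" "w \<notin> s" using V s finite_subset by auto
    have neq: "y \<noteq> u" "y \<noteq> v" "y \<noteq> w" if "y \<in> s" for y using that nin by auto
    have zero: "?M u y = 0" "?M y u = 0" if "y \<in> s" for y using that s M_uW by auto
    have turn: "?M v y = ?M y v" "?M w y = ?M y w" if "y \<in> s" for y by (rule M_simps(2))+
    have same: "corank t ?N = corank t ?M" if "finite t" "u \<notin> t" for t
    proof (rule corank_cong[OF that(1)])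
      show "?N i j = ?M i j" if "i \<in> t" "j \<in> t" for i j
        using that \<open>u \<notin> t\<close> by (intro N) auto
    qed
    show "corank s ?N = corank s ?M"
      "corank (insert v s) ?N = corank (insert v s) ?M"
      "corank (insert w s) ?N = corank (insert w s) ?M"
      "corank (insert v (insert w s)) ?N = corank (insert v (insert w s)) ?M"
      by (rule same; use fin nin uvw in simp)+
    show "corank (insert u s) ?M = Suc (corank s ?M)"
      by (rule corank_insert_dependent[OF fin nin(1), where c = "\<lambda>_. 0"])
        (auto simp: zero M_simps(1) intro: M_simps(2))
    \<comment> \<open>Row \<open>u\<close> vanishes on \<open>s\<close>, so eliminating
      \<open>u\<close> and \<open>v\<close> leaves the entries on \<open>s\<close>
      unchanged.\<close>
    show "corank (insert u (insert v s)) ?M = corank s ?M"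
      by (rule corank_pivot[OF fin nin(1,2) uvw(4)]) (simp_all add: M_u M_simps(1) zero)
    show "corank (insert u (insert w s)) ?M = corank s ?M"
      by (rule corank_pivot[OF fin nin(1,3) uvw(5)]) (simp_all add: M_u M_simps(1) zero)
    show "corank (insert u (insert v (insert w s))) ?M = corank (insert u s) ?N"
    proof -
      \<comment> \<open>Eliminating \<open>u\<close> and \<open>v\<close> adds row \<open>v\<close>
        to row \<open>w\<close>. The result is row \<open>u\<close> of \<open>?N\<close> once
        \<open>w\<close> is renamed to \<open>u\<close>.\<close>
      define L where "L i j = ?M i j + ?M i u * ?M v j + ?M i v * ?M u j" for i j
      have "corank (insert u (insert v (insert w s))) ?M = corank (insert w s) L"
        by (rule corank_pivot) (use fin nin uvw in \<open>auto simp: L_def M_u M_simps(1)\<close>)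
      also have "\<dots> = corank (insert u s) ?N"
      proof (rule corank_reindex[symmetric])
        show "bij_betw (id(w := u)) (insert w s) (insert u s)"
          using nin by (auto simp: bij_betw_def inj_on_def)
        show "?N ((id(w := u)) i) ((id(w := u)) j) = L i j"
          if "i \<in> insert w s" "j \<in> insert w s" for i j
          using that uvw neq zero
          by (auto simp: L_def N N_u N_uu M_u M_simps(1) turn ac_simps)
      qed (use fin in simp)
      finally show ?thesis .
    qed
    \<comment> \<open>In \<open>N\<close>, row \<open>u\<close> is the sum of rows \<open>v\<close> and \<open>w\<close>, so adding row \<open>p\<close> turns it into row \<open>q\<close>.\<close>
    have swap: "corank (insert u (insert p s)) ?N = corank (insert p (insert q s)) ?M"
      if pq: "p = v \<and> q = w \<or> p = w \<and> q = v" for p q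
    proof -
      define L where "L i j = ?N i j + ?N i p * (if j = u then 1 else 0)
        + (if i = u then 1 else 0) * ?N p j" for i j
      have p: "p \<notin> insert u s" "p \<noteq> u" "q \<noteq> u" "p \<noteq> q" "q \<notin> insert p s" "?N p p = 0"
        "?N p u = 0" "?N u p = 0"
        using pq nin uvw by (auto simp: N N_u M_simps(1) M_u)
      have "corank (insert p (insert u s)) L = corank (insert p (insert u s)) ?N"
        by (rule corank_add_row_col[where a = "\<lambda>j. if j = u then 1 else 0"
              and b = "\<lambda>i. if i = u then 1 else 0"])
          (use fin p neq in \<open>auto simp: L_def\<close>)
      moreover have "corank (insert p (insert q s)) ?M = corank (insert p (insert u s)) L"
      proof (rule corank_reindex)
        show "bij_betw (id(u := q)) (insert p (insert u s)) (insert p (insert q s))"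
          using nin p by (auto simp: bij_betw_def inj_on_def)
        have M_pq: "?M p q = 0" "?M q p = 0" using pq M_u by auto
        have u_row: "?M v y + ?M w y + ?M p y = ?M q y" for y
          using pq by (auto simp: ac_simps)
        show "?M ((id(u := q)) i) ((id(u := q)) j) = L i j"
          if "i \<in> insert p (insert u s)" "j \<in> insert p (insert u s)" for i j
          using that p neq u_row
          by (auto simp: L_def N N_u N_uu M_pq M_simps(1) M_simps(2)[of i p]
              M_simps(2)[of i q] u_row)
      qed (use fin in simp)
      ultimately show ?thesis by (simp add: insert_commute)
    qed
    show "corank (insert u (insert v s)) ?N = corank (insert v (insert w s)) ?M"
      using swap[of v w] by simp
    show "corank (insert u (insert w s)) ?N = corank (insert v (insert w s)) ?M"
      using swap[of w v] by (simp add: insert_commute)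
    have "corank (insert u (insert v (insert w s))) ?N = Suc (corank (insert v (insert w s)) ?N)"
    proof (rule corank_insert_dependent)
      show "finite (insert v (insert w s))" "u \<notin> insert v (insert w s)" using fin nin uvw by auto
      show "?N u j = (\<Sum>y\<in>insert v (insert w s). (if y = v \<or> y = w then 1 else 0) * ?N y j)"
        if "j \<in> insert u (insert v (insert w s))" for j
      proof -
        have "(\<Sum>y\<in>s. (if y = v \<or> y = w then 1 else 0) * ?N y j) = 0"
          by (rule sum.neutral) (simp add: neq)
        then have "(\<Sum>y\<in>insert v (insert w s). (if y = v \<or> y = w then 1 else 0) * ?N y j)
            = ?N v j + ?N w j"
          using fin nin uvw by simp
        then show ?thesis
          using that uvw by (cases "j = u") (simp_all add: N N_u N_uu M_simps(1) M_u)
      qed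
    qed (rule N_sym)+
    then show "corank (insert u (insert v (insert w s))) ?N
        = Suc (corank (insert v (insert w s)) ?M)"
      using same[of "insert v (insert w s)"] fin nin uvw by simp
  qed
  have H: "verts H = insert u (insert v (insert w W))" "\<And>x. x \<in> W \<Longrightarrow> lab H x = lab G x"
    "lab H u = Minus" "lab H v = Plus" "lab H w = Plus"
    using V uvw by (auto simp: H_def relabel_def toggle_def)
  have fin: "finite (insert w W)" "finite (insert v (insert w W))" using V by simp_all
  let ?b = "inverse a" and ?\<delta> = "loop_value a"
  \<comment> \<open>The left side lists the states of \<open>H\<close>, the right side those of
    \<open>G\<close>. The powers of \<open>?\<delta>\<close> for \<open>s\<close> extended by
    nothing, \<open>v\<close>, \<open>w\<close> and both are \<open>x\<close>, \<open>xv\<close>,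
    \<open>xw\<close> and \<open>y\<close>; \<open>z\<close> belongs to \<open>insert u s\<close> in
    \<open>H\<close>. The identity rests on \<open>?\<delta> = - (a ^ 2) - ?b ^ 2\<close>.\<close>
  have balance: "a * (a * (?b * x + a * z) + ?b * (?b * xv + a * y))
      + ?b * (a * (?b * xw + a * y) + ?b * (?b * y + a * (?\<delta> * y)))
    = ?b * (?b * (?b * x + a * (?\<delta> * x)) + a * (?b * xv + a * x))
      + a * (?b * (?b * xw + a * x) + a * (?b * y + a * z))" for x xv xw y z
    using a by (simp add: loop_value_def field_simps power2_eq_square)
  show ?thesis
    unfolding bracket_def H(1) V(1)
      state_sum_insert[OF fin(2) V(2)] state_sum_insert[OF fin(1) V(3)] state_sum_insert[OF V(5,4)]
    by (intro state_sum_cong)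
      (simp_all add: H coranks uvw smoothing_weight_def insert_commute balance)
qed

text \<open>
  Removing an isolated vertex multiplies the bracket by \<open>-(a^3)\<close> or its inverse, so the factors
  cancel in the following product and no writhe is needed.
\<close>

definition bracket_product :: "'a lgraph \<Rightarrow> real \<Rightarrow> real" where
  "bracket_product G a = bracket G a * bracket G (inverse a)"

lemma bracket_product_move:
  assumes "graph_move G H" and a: "a \<noteq> 0"
  shows "bracket_product G a = bracket_product H a"
  using assms(1)
proof cases
  case iso
  then show ?thesis by (simp add: bracket_product_def bracket_isomorphic)
next
  case (omega1 v)
  have "(smoothing_weight a l False + smoothing_weight a l True * loop_value a) *
      (smoothing_weight (inverse a) l False
        + smoothing_weight (inverse a) l True * loop_value (inverse a)) = 1" for l
    using a by (cases l)
      (simp_all add: smoothing_weight_def loop_value_def field_simps eval_nat_numeral)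
  then show ?thesis
    unfolding bracket_product_def omega1(1) bracket_omega1[OF omega1(2,3)]
    by (simp add: mult.assoc mult.left_commute)
next
  case (omega2 u v)
  then show ?thesis
    using a bracket_omega2[OF omega2(2-8)] by (simp add: bracket_product_def)
next
  case (omega3 u v w)
  then show ?thesis
    using a bracket_omega3[OF omega3(2-13)] by (simp add: bracket_product_def)
next
  case (omega4 u v)
  then show ?thesis
    using bracket_omega4[OF omega4(2-5)] by (simp add: bracket_product_def)
qed

lemma bracket_product_invariant:
  assumes "equivclp graph_move G H" and a: "a \<noteq> 0"
  shows "bracket_product G a = bracket_product H a"
  using assms(1) by (induction rule: equivclp_induct) (auto simp: bracket_product_move[OF _ a])

section \<open>The extreme coefficients\<close>

text \<open>The distance from the \<open>A\<close>-state, hence the number \<open>\<beta>\<close> of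
  factors \<open>inverse a\<close> in the weight of \<open>s\<close>.\<close>

definition disagreement :: "'a lgraph \<Rightarrow> 'a set \<Rightarrow> nat" where
  "disagreement G s = card {v \<in> verts G. (v \<in> s) \<noteq> (lab G v = Minus)}"

text \<open>
  The bracket at \<open>a = 1/b\<close>, multiplied by the power of \<open>b\<close> that makes all exponents nonnegative;
  the truncated subtraction is exact because the corank is at most the size of the state.
\<close>

definition bracket_poly :: "'a lgraph \<Rightarrow> real \<Rightarrow> real" where
  "bracket_poly G b = (\<Sum>s\<in>Pow (verts G).
     b ^ (2 * (disagreement G s + card (A_state G) - corank s (adj_matrix G)))
     * (- 1 - b ^ 4) ^ corank s (adj_matrix G))"

text \<open>Split \<open>s\<close> along the \<open>A\<close>-state. The term
  \<open>card (A_state G - s)\<close> is kept because it makes the bound strict for states missing a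
  vertex of the \<open>A\<close>-state.\<close>

lemma card_state_le:
  assumes "finite (verts G)" "s \<subseteq> verts G"
  shows "card s + card (A_state G - s) \<le> disagreement G s + card (A_state G)"
proof -
  let ?A = "A_state G"
  have fin: "finite ?A" "finite s" using assms by (auto simp: A_state_def intro: finite_subset)
  have "{v \<in> verts G. (v \<in> s) \<noteq> (lab G v = Minus)} = (s - ?A) \<union> (?A - s)"
    using assms by (auto simp: A_state_def)
  then have d: "disagreement G s = card (s - ?A) + card (?A - s)"
    unfolding disagreement_def using fin card_Un_disjoint[of "s - ?A" "?A - s"] by auto
  have "card s = card (s - ?A) + card (s \<inter> ?A)"
    using card_Int_Diff[OF fin(2), of ?A] by simp
  moreover have "card (s \<inter> ?A) \<le> card ?A" using fin by (intro card_mono) auto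
  ultimately show ?thesis using d by simp
qed

text \<open>One factor \<open>b\<close> per vertex turns the weights into 1 and
  \<open>b ^ 2\<close>; two factors per unit of corank turn the loop value into
  \<open>- 1 - b ^ 4\<close>. The bound on the corank leaves a nonnegative exponent.\<close>

lemma bracket_eq_bracket_poly:
  assumes fin: "finite (verts G)" and b: "b \<noteq> 0"
  shows "bracket G (inverse b) * b ^ (card (verts G) + 2 * card (A_state G)) = bracket_poly G b"
  unfolding bracket_def state_sum_def bracket_poly_def sum_distrib_right
proof (rule sum.cong)
  fix s assume "s \<in> Pow (verts G)"
  then have s: "s \<subseteq> verts G" by simp
  let ?c = "corank s (adj_matrix G)" and ?m = "card (A_state G)" and ?d = "disagreement G s"
  let ?w = "\<Prod>v\<in>verts G. smoothing_weight (inverse b) (lab G v) (v \<in> s)"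
  have "?w * b ^ card (verts G)
      = (\<Prod>v\<in>verts G. smoothing_weight (inverse b) (lab G v) (v \<in> s) * b)"
    by (simp add: prod.distrib)
  also have "\<dots> = (\<Prod>v\<in>verts G. if (v \<in> s) = (lab G v = Minus) then 1 else b ^ 2)"
    using b by (intro prod.cong) (auto simp: smoothing_weight_def power2_eq_square)
  also have "\<dots> = b ^ (2 * ?d)"
    using fin by (simp add: prod.If_cases disagreement_def power_mult Collect_neg_eq[symmetric]
        Collect_conj_eq[symmetric] Int_def)
  finally have w: "?w * b ^ card (verts G) = b ^ (2 * ?d)" .
  have "?c \<le> card s" by (simp add: corank_def)
  then have le: "?c \<le> ?d + ?m" using card_state_le[OF fin s] by simp
  have "2 * ?d + 2 * ?m = 2 * ?c + 2 * (?d + ?m - ?c)" using le by simp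
  then have d_m: "b ^ (2 * ?d) * b ^ (2 * ?m) = (b ^ 2) ^ ?c * b ^ (2 * (?d + ?m - ?c))"
    by (simp add: power_mult[symmetric] power_add[symmetric])
  have "loop_value (inverse b) * b ^ 2 = - 1 - b ^ 4"
    using b by (simp add: loop_value_def field_simps eval_nat_numeral)
  then have loop: "loop_value (inverse b) ^ ?c * (b ^ 2) ^ ?c = (- 1 - b ^ 4) ^ ?c"
    by (simp add: power_mult_distrib[symmetric])
  have "?w * loop_value (inverse b) ^ ?c * b ^ (card (verts G) + 2 * ?m)
      = loop_value (inverse b) ^ ?c * ((?w * b ^ card (verts G)) * b ^ (2 * ?m))"
    by (simp only: power_add mult.assoc mult.left_commute)
  also have "\<dots> = (loop_value (inverse b) ^ ?c * (b ^ 2) ^ ?c) * b ^ (2 * (?d + ?m - ?c))"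
    by (simp only: w d_m mult.assoc)
  finally show "?w * loop_value (inverse b) ^ ?c * b ^ (card (verts G) + 2 * ?m)
      = b ^ (2 * (?d + ?m - ?c)) * (- 1 - b ^ 4) ^ ?c"
    by (simp only: loop mult.commute)
qed simp

section \<open>Mirror images and the two ends of the bracket\<close>

definition mirror :: "'a lgraph \<Rightarrow> 'a lgraph" where
  "mirror G = G\<lparr>lab := opposite \<circ> lab G\<rparr>"

lemma mirror_simps [simp]:
  "verts (mirror G) = verts G" "adj (mirror G) = adj G" "lab (mirror G) v = opposite (lab G v)"
  "adj_matrix (mirror G) = adj_matrix G" "labeled_graph (mirror G) \<longleftrightarrow> labeled_graph G"
  "isolated (mirror G) v \<longleftrightarrow> isolated G v"
  by (simp_all add: mirror_def fun_eq_iff adj_matrix_def labeled_graph_def isolated_def nbhd_def)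

lemma opposite_eq_iff [simp]: "opposite k = opposite l \<longleftrightarrow> k = l"
  by (cases k; cases l) simp_all

text \<open>Opposite labels exchange the weights \<open>a\<close> and \<open>inverse a\<close>, and
  the loop value is symmetric in them. This lets one argument about the \<open>A\<close>-state also
  treat the \<open>B\<close>-state.\<close>

lemma bracket_mirror: "bracket (mirror G) a = bracket G (inverse a)"
proof -
  have "smoothing_weight a (opposite l) c = smoothing_weight (inverse a) l c" for l c
    by (cases l) (simp_all add: smoothing_weight_def)
  moreover have "loop_value (inverse a) = loop_value a" by (simp add: loop_value_def)
  ultimately show ?thesis by (simp add: bracket_def state_sum_def)
qed

text \<open>The two normalising exponents are \<open>?n + 2 * ?k\<close> and
  \<open>?n + 2 * ?l\<close>; as \<open>?k + ?l = ?n\<close>, their sum depends on the number of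
  vertices alone.\<close>

lemma bracket_product_eq_bracket_poly:
  assumes fin: "finite (verts G)" and b: "b \<noteq> 0"
  shows "bracket_product G (inverse b) * b ^ (4 * card (verts G))
    = bracket_poly G b * bracket_poly (mirror G) b"
proof -
  let ?n = "card (verts G)" and ?k = "card (A_state G)" and ?l = "card (A_state (mirror G))"
  have "opposite (lab G v) = Minus \<longleftrightarrow> lab G v \<noteq> Minus" for v by (cases "lab G v") simp_all
  then have "verts G = A_state G \<union> A_state (mirror G)" "A_state G \<inter> A_state (mirror G) = {}"
    by (auto simp: A_state_def)
  then have "?n = ?k + ?l" using fin by (metis card_Un_disjoint finite_Un)
  then have exp: "4 * ?n = (?n + 2 * ?k) + (?n + 2 * ?l)" by simp
  show ?thesis
    unfolding exp bracket_product_def power_add[of b "?n + 2 * ?k"]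
    using bracket_eq_bracket_poly[OF fin b, symmetric]
      bracket_eq_bracket_poly[of "mirror G" b, symmetric] fin b
    by (simp add: bracket_mirror mult.assoc mult.left_commute)
qed

text \<open>Only states whose corank reaches \<open>disagreement G s + card (A_state G)\<close>
  contribute to the constant term. The \<open>A\<close>-state has no edges and attains this bound;
  every other state misses a vertex of it or contains an edge. The hypotheses pass to the mirror
  image.\<close>

lemma bracket_poly_0:
  assumes G: "labeled_graph G"
    and bipartite: "\<And>u v. adj G u v \<Longrightarrow> lab G u \<noteq> lab G v"
    and not_isolated: "\<not> (\<exists>v. isolated G v)"
  shows "bracket_poly G 0 \<noteq> 0"
proof -
  let ?A = "A_state G"
  have fin: "finite (verts G)" using G by (simp add: labeled_graph_def)
  have A: "?A \<subseteq> verts G" by (auto simp: A_state_def)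
  have finA: "finite ?A" using A fin finite_subset by auto
  have cA: "corank ?A (adj_matrix G) = card ?A"
    unfolding corank_eq_card_iff[OF finA]
    using bipartite by (force simp: A_state_def adj_matrix_def)
  have dA: "disagreement G ?A = 0"
  proof -
    have "{v \<in> verts G. (v \<in> ?A) \<noteq> (lab G v = Minus)} = {}" by (auto simp: A_state_def)
    then show ?thesis by (simp only: disagreement_def card.empty)
  qed
  have strict: "corank s (adj_matrix G) < disagreement G s + card ?A"
    if s: "s \<subseteq> verts G" "s \<noteq> ?A" for s
  proof -
    have fins: "finite s" using s fin finite_subset by auto
    have le: "corank s (adj_matrix G) \<le> card s" by (simp add: corank_def)
    note bound = card_state_le[OF fin s(1)]
    show ?thesis
    proof (cases "?A \<subseteq> s")
      case False
      then have "card (?A - s) > 0" using finA by (auto simp: card_gt_0_iff)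
      then show ?thesis using le bound by simp
    next
      case True
      then obtain v where v: "v \<in> s" "v \<notin> ?A" using s by auto
      \<comment> \<open>A neighbour of the additional vertex \<open>v\<close> has label
        \<open>Minus\<close>, so it already lies in \<open>s\<close> and gives an edge
        there.\<close>
      then obtain u where u: "adj G v u" "u \<in> verts G"
        using not_isolated s(1) by (auto simp: isolated_def nbhd_def)
      have "lab G v = Plus" using v s(1) by (cases "lab G v") (auto simp: A_state_def)
      then have "lab G u = Minus" using bipartite[OF u(1)] by (cases "lab G u") auto
      then have "u \<in> s" using u True by (auto simp: A_state_def)
      then have "corank s (adj_matrix G) \<noteq> card s"
        unfolding corank_eq_card_iff[OF fins] using u v by (force simp: adj_matrix_def)
      then show ?thesis using le bound by simp
    qed
  qed
  \<comment> \<open>Since \<open>0 ^ 0 = 1\<close>, exactly the states with exponent zero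
    survive.\<close>
  have "bracket_poly G 0 = (\<Sum>s\<in>Pow (verts G). if s = ?A then (- 1) ^ card ?A else 0)"
    unfolding bracket_poly_def
  proof (rule sum.cong)
    fix s assume "s \<in> Pow (verts G)"
    then show "0 ^ (2 * (disagreement G s + card ?A - corank s (adj_matrix G)))
        * (- 1 - 0 ^ 4) ^ corank s (adj_matrix G) = (if s = ?A then (- 1) ^ card ?A else (0::real))"
      using strict[of s] by (auto simp: cA dA zero_power)
  qed simp
  also have "\<dots> = (- 1) ^ card ?A" using A fin by simp
  finally show ?thesis by simp
qed

text \<open>The coranks of the two states are bounded by their sizes, which add up to the number of
  vertices. Alternation forces equality in both bounds, so neither state contains an edge.\<close>

lemma alternating_imp_bipartite:
  assumes G: "labeled_graph G" and "alternating G" and uv: "adj G u v"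
  shows "lab G u \<noteq> lab G v"
proof
  assume eq: "lab G u = lab G v"
  let ?M = "\<lambda>s. adj_matrix (induced G s)"
  have fin: "finite (A_state G)" "finite (B_state G)"
    using G by (auto simp: labeled_graph_def A_state_def B_state_def)
  have "lab G w = Plus \<or> lab G w = Minus" for w using sign.exhaust by blast
  then have "verts G = A_state G \<union> B_state G" "A_state G \<inter> B_state G = {}"
    by (auto simp: A_state_def B_state_def)
  then have "card (verts G) = card (A_state G) + card (B_state G)"
    using fin by (simp add: card_Un_disjoint)
  then have "corank (A_state G) (?M (A_state G)) + corank (B_state G) (?M (B_state G))
      = card (A_state G) + card (B_state G)"
    using assms(2) by (simp add: alternating_def circles_def)
  moreover have "corank s (?M s) \<le> card s" for s by (simp add: corank_def)
  ultimately have "corank s (?M s) = card s" if "s = A_state G \<or> s = B_state G" for s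
    using that by (metis add_le_cancel_left add_le_cancel_right nle_le)
  then have zero: "?M s i j = 0" if "s = A_state G \<or> s = B_state G" "i \<in> s" "j \<in> s" for s i j
    using that corank_eq_card_iff fin by metis
  have "u \<in> verts G" "v \<in> verts G" using G uv unfolding labeled_graph_def by blast+
  then have "u \<in> A_state G \<and> v \<in> A_state G \<or> u \<in> B_state G \<and> v \<in> B_state G"
    using eq by (cases "lab G u") (simp_all add: A_state_def B_state_def)
  then obtain s where "s = A_state G \<or> s = B_state G" "u \<in> s" "v \<in> s" by blast
  with zero[of s u v] uv show False by (simp add: adj_matrix_def induced_def)
qed

theorem theorem6p2:
  fixes G :: "'a::infinite lgraph"
  assumes "labeled_graph G"
    and "alternating G"
    and "\<not> (\<exists>v. isolated G v)"
  shows "minimal G"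
  unfolding minimal_def
proof
  assume "\<exists>G'. labeled_graph G' \<and> card (verts G') < card (verts G) \<and> graph_link G' = graph_link G"
  then obtain G' :: "'a lgraph" where G': "labeled_graph G'" "card (verts G') < card (verts G)"
    "graph_link G' = graph_link G" by blast
  have fin: "finite (verts G)" "finite (verts G')"
    using assms(1) G'(1) by (simp_all add: labeled_graph_def)
  have equiv: "equivclp graph_move G' G" using graph_link_eq_iff[OF G'(1) assms(1)] G'(3) by simp
  define k where "k = card (verts G) - card (verts G')"
  let ?P = "\<lambda>H b. bracket_poly H b * bracket_poly (mirror H) b"
  have "k > 0" using G'(2) by (simp add: k_def)
  \<comment> \<open>Both graphs have the same bracket product, so their normalised products differ
    by the power of \<open>b\<close> coming from the \<open>k\<close> missing vertices.\<close>
  have eq: "?P G b = b ^ (4 * k) * ?P G' b" if "b > 0" for b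
  proof -
    have exp: "4 * card (verts G) = 4 * card (verts G') + 4 * k" using G'(2) by (simp add: k_def)
    have "?P G b = bracket_product G (inverse b) * b ^ (4 * card (verts G))"
      using bracket_product_eq_bracket_poly[OF fin(1)] that by simp
    also have "\<dots> = b ^ (4 * k) * (bracket_product G' (inverse b) * b ^ (4 * card (verts G')))"
      using bracket_product_invariant[OF equiv, of "inverse b"] that
      by (simp add: exp power_add)
    finally show ?thesis using bracket_product_eq_bracket_poly[OF fin(2)] that by simp
  qed
  \<comment> \<open>The comparison holds for positive \<open>b\<close> only; continuity carries it
    to 0, where \<open>b ^ (4 * k)\<close> vanishes while both constant terms for \<open>G\<close>
    are nonzero.\<close>
  have cont: "(?P H \<longlongrightarrow> ?P H 0) (at_right 0)" for H :: "'a lgraph"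
    unfolding bracket_poly_def by (intro tendsto_intros)
  have "((\<lambda>b. b ^ (4 * k) * ?P G' b) \<longlongrightarrow> 0 ^ (4 * k) * ?P G' 0) (at_right 0)"
    by (intro tendsto_mult[OF _ cont] tendsto_intros)
  moreover have "\<forall>\<^sub>F b in at_right 0. b ^ (4 * k) * ?P G' b = ?P G b"
    using eq by (auto simp: eventually_at_right_field intro: exI[of _ 1])
  ultimately have "(?P G \<longlongrightarrow> 0 ^ (4 * k) * ?P G' 0) (at_right 0)"
    by (rule Lim_transform_eventually)
  moreover have "(0::real) ^ (4 * k) = 0" using \<open>k > 0\<close> by simp
  ultimately have "?P G 0 = 0" using tendsto_unique[OF _ _ cont[of G]] by fastforce
  moreover have "bracket_poly G 0 \<noteq> 0" "bracket_poly (mirror G) 0 \<noteq> 0"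
    by (rule bracket_poly_0; use alternating_imp_bipartite[OF assms(1,2)] assms(1,3) in simp)+
  ultimately show False by simp
qed

end
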